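(* Let $T$ be a non-trivial subresiduated Nelson algebra (i.e. with more than one element). The following conditions are equivalent: 1) $T$ is subdirectly irreducible. 2) There exists $x\in T\setminus\{1\}$ such that for every $y\in T\setminus\{1\}$, $\square(y)\to x=1$, where $\square(y)=1\to y$.
   Context: A Kleene algebra is a bounded distributive lattice $\langle T,\wedge,\vee,0,1\rangle$ with a unary operation $\sim$ satisfying $\sim\sim x=x$, $\sim(x\wedge y)=\sim x\vee\sim y$, $(x\wedge\sim x)\wedge(y\vee\sim y)=x\wedge\sim x$. A subresiduated Nelson algebra is an algebra $\langle T,\wedge,\vee,\to,\sim,0,1\rangle$ of type $(2,2,2,1,0,0)$ such that $\langle T,\wedge,\vee,\sim,0,1\rangle$ is a Kleene algebra and for all $x,y,z\in T$: (1) $(x\vee y)\to z=(x\to z)\wedge(y\to z)$; (2) $z\to(x\wedge y)=(z\to x)\wedge(z\to y)$; (3) $((x\to y)\wedge(y\to z))\to(x\to z)=1$; (4) $x\to x=1$; (5) $x\wedge(x\to y)\le x\wedge(\sim x\vee y)$; (6) $x\to y\le z\to(x\to y)$; (7) $\sim(x\to y)\to(x\wedge\sim y)=1$; (8) $(x\wedge\sim y)\to\sim(x\to y)=1$. A non-trivial algebra is subdirectly irreducible if it has a least congruence among those different from the identity relation. *)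

theory Defs
  imports Main
begin

unbundle lattice_syntax

text \<open>The bounds \<open>0\<close> and \<open>1\<close> of the algebras are \<open>\<bottom>\<close> and \<open>\<top>\<close>.\<close>

class kleene_algebra = distrib_lattice + bounded_lattice +
  fixes neg :: "'a \<Rightarrow> 'a"  ("\<sim> _" [81] 80)
  assumes neg_neg: "\<sim> (\<sim> x) = x"
    and neg_inf: "\<sim> (x \<sqinter> y) = \<sim> x \<squnion> \<sim> y"
    and kleene: "(x \<sqinter> \<sim> x) \<sqinter> (y \<squnion> \<sim> y) = x \<sqinter> \<sim> x"

class subresiduated_nelson_algebra = kleene_algebra +
  fixes imp :: "'a \<Rightarrow> 'a \<Rightarrow> 'a"  (infixr "\<leadsto>" 60)
  assumes sup_imp: "(x \<squnion> y) \<leadsto> z = (x \<leadsto> z) \<sqinter> (y \<leadsto> z)"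
    and imp_inf: "z \<leadsto> (x \<sqinter> y) = (z \<leadsto> x) \<sqinter> (z \<leadsto> y)"
    and imp_trans: "((x \<leadsto> y) \<sqinter> (y \<leadsto> z)) \<leadsto> (x \<leadsto> z) = \<top>"
    and imp_refl: "x \<leadsto> x = \<top>"
    and inf_imp_le: "x \<sqinter> (x \<leadsto> y) \<le> x \<sqinter> (\<sim> x \<squnion> y)"
    and imp_le_imp: "x \<leadsto> y \<le> z \<leadsto> (x \<leadsto> y)"
    and neg_imp_imp: "\<sim> (x \<leadsto> y) \<leadsto> (x \<sqinter> \<sim> y) = \<top>"
    and imp_neg_imp: "(x \<sqinter> \<sim> y) \<leadsto> \<sim> (x \<leadsto> y) = \<top>"

definition box :: "'a::subresiduated_nelson_algebra \<Rightarrow> 'a"  ("\<box>") where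
  "\<box> y = \<top> \<leadsto> y"

definition congruence :: "('a::subresiduated_nelson_algebra \<times> 'a) set \<Rightarrow> bool" where
  "congruence \<theta> \<longleftrightarrow> equiv UNIV \<theta> \<and>
     (\<forall>x x' y y'. (x, x') \<in> \<theta> \<longrightarrow> (y, y') \<in> \<theta> \<longrightarrow>
        (x \<sqinter> y, x' \<sqinter> y') \<in> \<theta> \<and> (x \<squnion> y, x' \<squnion> y') \<in> \<theta> \<and> (x \<leadsto> y, x' \<leadsto> y') \<in> \<theta>) \<and>
     (\<forall>x x'. (x, x') \<in> \<theta> \<longrightarrow> (\<sim> x, \<sim> x') \<in> \<theta>)"

definition nontrivial :: "'a::subresiduated_nelson_algebra itself \<Rightarrow> bool" where
  "nontrivial _ \<longleftrightarrow> (\<exists>x y :: 'a. x \<noteq> y)"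

definition subdirectly_irreducible :: "'a::subresiduated_nelson_algebra itself \<Rightarrow> bool" where
  "subdirectly_irreducible T \<longleftrightarrow> nontrivial T \<and>
     (\<exists>\<mu> :: ('a \<times> 'a) set. congruence \<mu> \<and> \<mu> \<noteq> Id \<and>
        (\<forall>\<theta>. congruence \<theta> \<and> \<theta> \<noteq> Id \<longrightarrow> \<mu> \<subseteq> \<theta>))"

end

theory Submission
  imports Defs
begin

text \<open>
  The relation \<open>x \<leadsto> y = \<top>\<close> is a preorder which in general is weaker than \<open>\<le>\<close>, but
  \<open>x = y\<close> holds as soon as \<open>x \<leadsto> y\<close>, \<open>y \<leadsto> x\<close>, \<open>\<sim> x \<leadsto> \<sim> y\<close> and \<open>\<sim> y \<leadsto> \<sim> x\<close> all equal
  \<open>\<top>\<close> (lemma \<open>le_if_imp_eq_top\<close>). The meet of these four elements, \<open>bires x y\<close> below, is thus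
  \<open>\<top>\<close> exactly on the diagonal, and every congruence containing \<open>(x, y)\<close> identifies \<open>bires x y\<close>
  with \<open>\<top>\<close>.

  An element \<open>z\<close> with \<open>\<box> z = z\<close> admits the residuation law of lemma \<open>open_residuation\<close>. It
  follows that the pairs \<open>(x, y)\<close> with \<open>z \<leadsto> bires x y = \<top>\<close> form a congruence \<open>cong_of z\<close>, and
  that this congruence identifies \<open>z\<close> with \<open>\<top>\<close>.

  If \<open>\<mu>\<close> is a least nonidentity congruence and \<open>(u, v) \<in> \<mu>\<close> with \<open>u \<noteq> v\<close>, then
  \<open>\<mu> \<subseteq> cong_of (\<box> y)\<close> for every \<open>y \<noteq> \<top>\<close>, which gives \<open>\<box> y \<leadsto> bires u v = \<top>\<close>; so
  \<open>bires u v\<close> is the required element. Conversely, let \<open>x\<close> be such an element and \<open>\<theta>\<close> a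
  congruence containing \<open>(u, v)\<close> with \<open>u \<noteq> v\<close>. Modulo \<open>\<theta>\<close>, the element \<open>y = bires u v\<close> becomes
  \<open>\<top>\<close>, hence so does \<open>\<box> y\<close>, and \<open>\<top> = \<box> y \<leadsto> x\<close> becomes \<open>\<box> x\<close>. Since
  \<open>\<box> x \<noteq> \<top>\<close>, a single pair \<open>(\<box> x, \<top>)\<close> off the diagonal lies in every nonidentity
  congruence, and their intersection is the least one.
\<close>

section \<open>The preorder given by the implication\<close>

lemma neg_top: "\<sim> \<top> = (\<bottom> :: 'a::kleene_algebra)"
  by (metis inf_top_left neg_inf neg_neg sup_bot.right_neutral)

lemma neg_sup: "\<sim> (x \<squnion> y) = \<sim> x \<sqinter> \<sim> (y :: 'a::kleene_algebra)"
  by (metis neg_inf neg_neg)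

lemma box_le: "\<box> y \<le> (y :: 'a::subresiduated_nelson_algebra)"
  using inf_imp_le[of \<top> y] by (simp add: box_def neg_top)

lemma top_imp_eq_top_iff: "\<top> \<leadsto> y = \<top> \<longleftrightarrow> y = (\<top> :: 'a::subresiduated_nelson_algebra)"
  using box_le[of y] by (auto simp: box_def imp_refl top_unique)

lemma imp_if_le:
  fixes x y :: "'a::subresiduated_nelson_algebra"
  assumes "x \<le> y"
  shows "x \<leadsto> y = \<top>"
  using imp_inf[of x x y] assms by (simp add: imp_refl inf.absorb1)

lemma imp_eq_top_trans:
  fixes x y z :: "'a::subresiduated_nelson_algebra"
  assumes "x \<leadsto> y = \<top>" and "y \<leadsto> z = \<top>"
  shows "x \<leadsto> z = \<top>"
  using imp_trans[of x y z] assms by (simp add: top_imp_eq_top_iff)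

lemma box_imp: "\<box> (x \<leadsto> y) = x \<leadsto> (y :: 'a::subresiduated_nelson_algebra)"
  by (rule antisym[OF box_le]) (simp add: box_def imp_le_imp)

text \<open>
  The instance \<open>x = y\<close> of the law \<open>imp_neg_imp\<close>, since \<open>\<sim> (x \<leadsto> x) = \<bottom>\<close>.
\<close>
lemma inf_neg_imp_bot: "(x \<sqinter> \<sim> x) \<leadsto> \<bottom> = (\<top> :: 'a::subresiduated_nelson_algebra)"
  using imp_neg_imp[of x x] by (simp add: imp_refl neg_top)

text \<open>
  By \<open>inf_imp_le\<close> the first hypothesis puts \<open>x\<close> below \<open>\<sim> x \<squnion> y\<close>, and the second, after negation,
  puts \<open>x \<sqinter> \<sim> y\<close> below \<open>y\<close>. The Kleene inequality bounds \<open>x \<sqinter> \<sim> x\<close> by \<open>y \<squnion> \<sim> y\<close>, so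
  \<open>x \<le> y \<squnion> \<sim> y\<close>, and distributivity gives \<open>x \<le> y\<close>.
\<close>
lemma le_if_imp_eq_top:
  fixes x y :: "'a::subresiduated_nelson_algebra"
  assumes "x \<leadsto> y = \<top>" and "\<sim> y \<leadsto> \<sim> x = \<top>"
  shows "x \<le> y"
proof -
  have "x \<le> \<sim> x \<squnion> y"
    using inf_imp_le[of x y] assms(1) by simp
  then have "x = (x \<sqinter> \<sim> x) \<squnion> (x \<sqinter> y)"
    by (metis inf.absorb1 inf_sup_distrib1)
  moreover have "x \<sqinter> \<sim> x \<le> y \<squnion> \<sim> y"
    using kleene[of x y] by (metis inf.cobounded2)
  ultimately have "x \<le> y \<squnion> \<sim> y"
    by (metis inf.cobounded2 le_supI sup.coboundedI1)
  then have split: "x = (x \<sqinter> y) \<squnion> (x \<sqinter> \<sim> y)"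
    by (metis inf.absorb1 inf_sup_distrib1)
  have "\<sim> y \<le> y \<squnion> \<sim> x"
    using inf_imp_le[of "\<sim> y" "\<sim> x"] assms(2) by (simp add: neg_neg)
  then have "\<sim> (y \<squnion> \<sim> x) \<le> \<sim> (\<sim> y)"
    by (metis inf.absorb1 neg_inf sup.cobounded2)
  then have "x \<sqinter> \<sim> y \<le> y"
    by (simp add: neg_sup neg_neg inf_commute)
  then show ?thesis
    using split by (metis inf.cobounded2 le_supI)
qed

section \<open>The congruence of an open element\<close>

text \<open>
  Since \<open>z\<close> is itself the implication \<open>\<top> \<leadsto> z\<close>, the law \<open>imp_le_imp\<close> gives \<open>z \<le> w \<leadsto> z\<close>, and
  \<open>w \<leadsto> z\<close> equals \<open>w \<leadsto> (z \<sqinter> w)\<close>.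
\<close>
lemma open_residuation:
  fixes z w v :: "'a::subresiduated_nelson_algebra"
  assumes "\<box> z = z" and "(z \<sqinter> w) \<leadsto> v = \<top>"
  shows "z \<leadsto> (w \<leadsto> v) = \<top>"
proof -
  have "z \<le> w \<leadsto> z"
    using imp_le_imp[of \<top> z w] assms(1) by (simp add: box_def)
  then have "z \<leadsto> (w \<leadsto> (z \<sqinter> w)) = \<top>"
    by (simp add: imp_inf imp_refl imp_if_le)
  moreover have "(w \<leadsto> (z \<sqinter> w)) \<leadsto> (w \<leadsto> v) = \<top>"
    using imp_trans[of w "z \<sqinter> w" v] assms(2) by simp
  ultimately show ?thesis
    by (rule imp_eq_top_trans)
qed

text \<open>
  The preorder \<open>x \<leadsto> y = \<top>\<close> relativised to an element \<open>z\<close>; the original one is the case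
  \<open>z = \<top>\<close>.
\<close>
definition entails :: "'a::subresiduated_nelson_algebra \<Rightarrow> 'a \<Rightarrow> 'a \<Rightarrow> bool" where
  "entails z x y \<longleftrightarrow> z \<leadsto> (x \<leadsto> y) = \<top>"

lemma entails_if_imp: "x \<leadsto> y = \<top> \<Longrightarrow> entails z x y"
  by (simp add: entails_def imp_if_le)

lemma entails_trans:
  assumes "entails z x y" and "entails z y w"
  shows "entails z x w"
proof -
  have "z \<leadsto> ((x \<leadsto> y) \<sqinter> (y \<leadsto> w)) = \<top>"
    using assms by (simp add: entails_def imp_inf)
  then show ?thesis
    unfolding entails_def by (rule imp_eq_top_trans[OF _ imp_trans])
qed

lemma entails_inf:
  assumes "entails z x x'" and "entails z y y'"
  shows "entails z (x \<sqinter> y) (x' \<sqinter> y')"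
proof -
  have "entails z (x \<sqinter> y) x'" "entails z (x \<sqinter> y) y'"
    using assms entails_trans[of z "x \<sqinter> y" x x'] entails_trans[of z "x \<sqinter> y" y y']
    by (simp_all add: entails_if_imp imp_if_le)
  then show ?thesis
    by (simp add: entails_def imp_inf)
qed

lemma entails_sup:
  assumes "entails z x x'" and "entails z y y'"
  shows "entails z (x \<squnion> y) (x' \<squnion> y')"
proof -
  have "entails z x (x' \<squnion> y')" "entails z y (x' \<squnion> y')"
    using assms entails_trans[of z x x' "x' \<squnion> y'"] entails_trans[of z y y' "x' \<squnion> y'"]
    by (simp_all add: entails_if_imp imp_if_le)
  then show ?thesis
    by (simp add: entails_def sup_imp imp_inf)
qed

text \<open>
  The meet of \<open>z\<close> and \<open>x \<leadsto> y\<close> implies each link of the chain from \<open>x'\<close> over \<open>x\<close> and \<open>y\<close> to \<open>y'\<close>,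
  hence it implies \<open>x' \<leadsto> y'\<close>; residuation then moves \<open>x \<leadsto> y\<close> to the right.
\<close>
lemma entails_imp:
  assumes "\<box> z = z" and "entails z x' x" and "entails z y y'"
  shows "entails z (x \<leadsto> y) (x' \<leadsto> y')"
proof -
  let ?m = "z \<sqinter> (x \<leadsto> y)"
  have "?m \<leadsto> z = \<top>"
    by (simp add: imp_if_le)
  then have "entails ?m x' x" "entails ?m y y'"
    using assms(2,3) unfolding entails_def by (blast intro: imp_eq_top_trans)+
  moreover have "entails ?m x y"
    by (simp add: entails_def imp_if_le)
  ultimately have "entails ?m x' y'"
    by (blast intro: entails_trans)
  then show ?thesis
    using open_residuation[OF assms(1)] by (simp add: entails_def)
qed

text \<open>
  The laws \<open>neg_imp_imp\<close> and \<open>imp_neg_imp\<close> make \<open>\<sim> (x \<leadsto> y)\<close> equivalent to \<open>x \<sqinter> \<sim> y\<close> for the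
  preorder, which reduces the claim to meets.
\<close>
lemma entails_neg_imp:
  assumes "entails z x x'" and "entails z (\<sim> y) (\<sim> y')"
  shows "entails z (\<sim> (x \<leadsto> y)) (\<sim> (x' \<leadsto> y'))"
  using entails_inf[OF assms] entails_if_imp[OF neg_imp_imp] entails_if_imp[OF imp_neg_imp]
  by (blast intro: entails_trans)

definition bires :: "'a::subresiduated_nelson_algebra \<Rightarrow> 'a \<Rightarrow> 'a" where
  "bires x y = (x \<leadsto> y) \<sqinter> (y \<leadsto> x) \<sqinter> (\<sim> x \<leadsto> \<sim> y) \<sqinter> (\<sim> y \<leadsto> \<sim> x)"

lemma bires_eq_top_iff: "bires x y = \<top> \<longleftrightarrow> x = y"
proof
  assume "bires x y = \<top>"
  then show "x = y"
    by (auto simp: bires_def intro: antisym le_if_imp_eq_top)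
qed (simp add: bires_def imp_refl)

definition cong_of :: "'a::subresiduated_nelson_algebra \<Rightarrow> ('a \<times> 'a) set" where
  "cong_of z = {(x, y). z \<leadsto> bires x y = \<top>}"

lemma cong_of_iff:
  "(x, y) \<in> cong_of z \<longleftrightarrow>
    entails z x y \<and> entails z y x \<and> entails z (\<sim> x) (\<sim> y) \<and> entails z (\<sim> y) (\<sim> x)"
  by (simp add: cong_of_def bires_def entails_def imp_inf)

lemma congruence_cong_of:
  assumes "\<box> z = z"
  shows "congruence (cong_of z)"
proof -
  have "refl (cong_of z)"
    by (auto intro!: refl_onI simp: cong_of_iff entails_if_imp imp_refl)
  moreover have "sym (cong_of z)"
    by (auto intro!: symI simp: cong_of_iff)
  moreover have "trans (cong_of z)"
    unfolding trans_def cong_of_iff by (blast intro: entails_trans)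
  ultimately have "equiv UNIV (cong_of z)"
    by (simp add: equiv_def)
  moreover have "(x \<sqinter> y, x' \<sqinter> y') \<in> cong_of z" "(x \<squnion> y, x' \<squnion> y') \<in> cong_of z"
    "(x \<leadsto> y, x' \<leadsto> y') \<in> cong_of z"
    if "(x, x') \<in> cong_of z" and "(y, y') \<in> cong_of z" for x x' y y'
    using that unfolding cong_of_iff neg_inf neg_sup
    by (simp_all add: entails_inf entails_sup entails_imp[OF assms] entails_neg_imp)
  moreover have "(\<sim> x, \<sim> x') \<in> cong_of z" if "(x, x') \<in> cong_of z" for x x'
    using that by (simp add: cong_of_iff neg_neg)
  ultimately show ?thesis
    by (simp add: congruence_def)
qed

text \<open>
  Of the four components of \<open>bires z \<top>\<close> only \<open>\<top> \<leadsto> z = z\<close> and \<open>\<sim> z \<leadsto> \<bottom>\<close> can differ from \<open>\<top>\<close>. The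
  latter is implied by \<open>z\<close> because \<open>z \<sqinter> \<sim> z\<close> implies \<open>\<bottom>\<close>.
\<close>
lemma open_top_mem_cong_of:
  assumes "\<box> z = z"
  shows "(z, \<top>) \<in> cong_of z"
proof -
  have "z \<leadsto> (\<sim> z \<leadsto> \<bottom>) = \<top>"
    using open_residuation[OF assms] inf_neg_imp_bot by blast
  moreover have "entails z \<top> z"
    using assms by (simp add: entails_def box_def imp_refl)
  ultimately show ?thesis
    by (simp add: cong_of_iff neg_top entails_if_imp imp_if_le) (simp add: entails_def)
qed

section \<open>Arbitrary congruences\<close>

lemma congruence_bires_top:
  assumes "congruence \<theta>" and "(x, y) \<in> \<theta>"
  shows "(bires x y, \<top>) \<in> \<theta>"
proof -
  have eq: "equiv UNIV \<theta>"
    using assms(1) by (simp add: congruence_def)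
  have refl: "(u, u) \<in> \<theta>" for u
    using eq by (auto simp: equiv_def refl_on_def)
  have imp: "(a \<leadsto> b, a' \<leadsto> b') \<in> \<theta>" and inf: "(a \<sqinter> b, a' \<sqinter> b') \<in> \<theta>"
    if "(a, a') \<in> \<theta>" "(b, b') \<in> \<theta>" for a a' b b'
    using that assms(1) by (simp_all add: congruence_def)
  have neg: "(\<sim> x, \<sim> y) \<in> \<theta>"
    using assms by (simp add: congruence_def)
  have "(bires x y, bires y y) \<in> \<theta>"
    unfolding bires_def by (intro inf imp refl neg assms(2))
  then show ?thesis
    using bires_eq_top_iff[of y y] by simp
qed

lemma congruence_Inter:
  assumes "\<And>\<theta>. \<theta> \<in> S \<Longrightarrow> congruence \<theta>"
  shows "congruence (\<Inter> S)"
proof -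
  have "refl (\<Inter> S)" "sym (\<Inter> S)" "trans (\<Inter> S)"
    using assms unfolding congruence_def equiv_def refl_on_def sym_def trans_def by blast+
  then have "equiv UNIV (\<Inter> S)"
    by (simp add: equiv_def)
  then show ?thesis
    using assms unfolding congruence_def by blast
qed

lemma congruence_neq_IdE:
  assumes "congruence \<theta>" and "\<theta> \<noteq> Id"
  obtains u v where "(u, v) \<in> \<theta>" and "u \<noteq> v"
proof -
  have "Id \<subseteq> \<theta>"
    using assms(1) by (auto simp: congruence_def equiv_def refl_on_def)
  with assms(2) that show thesis
    by auto
qed

section \<open>Subdirect irreducibility\<close>

theorem proposition4p14:
  assumes "nontrivial TYPE('a::subresiduated_nelson_algebra)"
  shows "subdirectly_irreducible TYPE('a) \<longleftrightarrow>
    (\<exists>x \<in> UNIV - {\<top> :: 'a}. \<forall>y \<in> UNIV - {\<top>}. \<box> y \<leadsto> x = \<top>)"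
proof
  assume "subdirectly_irreducible TYPE('a)"
  then obtain \<mu> :: "('a \<times> 'a) set" where \<mu>: "congruence \<mu>" "\<mu> \<noteq> Id"
    and least: "\<And>\<theta>. congruence \<theta> \<Longrightarrow> \<theta> \<noteq> Id \<Longrightarrow> \<mu> \<subseteq> \<theta>"
    unfolding subdirectly_irreducible_def by blast
  obtain u v where uv: "(u, v) \<in> \<mu>" "u \<noteq> v"
    using \<mu> by (rule congruence_neq_IdE)
  have "\<box> y \<leadsto> bires u v = \<top>" if "y \<noteq> \<top>" for y
  proof -
    have op: "\<box> (\<box> y) = \<box> y"
      unfolding box_def[of y] by (rule box_imp)
    have "\<box> y \<noteq> \<top>"
      using that by (simp add: box_def top_imp_eq_top_iff)
    then have "cong_of (\<box> y) \<noteq> Id"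
      using open_top_mem_cong_of[OF op] by auto
    then have "\<mu> \<subseteq> cong_of (\<box> y)"
      using least congruence_cong_of[OF op] by blast
    with uv(1) show ?thesis
      by (auto simp: cong_of_def)
  qed
  then show "\<exists>x \<in> UNIV - {\<top> :: 'a}. \<forall>y \<in> UNIV - {\<top>}. \<box> y \<leadsto> x = \<top>"
    using uv(2) bires_eq_top_iff[of u v] by blast
next
  assume "\<exists>x \<in> UNIV - {\<top> :: 'a}. \<forall>y \<in> UNIV - {\<top>}. \<box> y \<leadsto> x = \<top>"
  then obtain x :: 'a where x: "x \<noteq> \<top>" "\<And>y. y \<noteq> \<top> \<Longrightarrow> \<box> y \<leadsto> x = \<top>"
    by blast
  have mem: "(\<box> x, \<top>) \<in> \<theta>" if \<theta>: "congruence \<theta>" "\<theta> \<noteq> Id" for \<theta>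
  proof -
    obtain u v where uv: "(u, v) \<in> \<theta>" "u \<noteq> v"
      using \<theta> by (rule congruence_neq_IdE)
    let ?y = "bires u v"
    have eq: "equiv UNIV \<theta>"
      using \<theta>(1) by (simp add: congruence_def)
    have refl: "(w, w) \<in> \<theta>" for w
      using eq by (auto simp: equiv_def refl_on_def)
    have imp: "(a \<leadsto> b, a' \<leadsto> b') \<in> \<theta>" if "(a, a') \<in> \<theta>" "(b, b') \<in> \<theta>" for a a' b b'
      using that \<theta>(1) by (simp add: congruence_def)
    have "(\<box> ?y, \<top>) \<in> \<theta>"
      using imp[OF refl congruence_bires_top[OF \<theta>(1) uv(1)], of \<top>] by (simp add: box_def imp_refl)
    then have "(\<box> ?y \<leadsto> x, \<box> x) \<in> \<theta>"
      unfolding box_def[of x] using refl by (rule imp)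
    then have "(\<top>, \<box> x) \<in> \<theta>"
      using x(2)[of ?y] uv(2) by (simp add: bires_eq_top_iff)
    then show ?thesis
      using eq by (auto simp: equiv_def sym_def)
  qed
  let ?\<mu> = "\<Inter> {\<theta> :: ('a \<times> 'a) set. congruence \<theta> \<and> \<theta> \<noteq> Id}"
  have "congruence ?\<mu>"
    by (rule congruence_Inter) blast
  moreover have "\<box> x \<noteq> \<top>"
    using x(1) by (simp add: box_def top_imp_eq_top_iff)
  then have "?\<mu> \<noteq> Id"
    using mem by auto
  ultimately show "subdirectly_irreducible TYPE('a)"
    unfolding subdirectly_irreducible_def using assms by blast
qed

end
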